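(* Let $d>1$, let $p\in[1,\infty)$, and let $\mu,\nu\in P_p(\mathbb{R}^d)$ be two probability measures which both have the comonotonicity copula. That is, writing $F_i$ and $G_i$ ($i=1,\dots,d$) for the distribution functions of the one-dimensional margins of $\mu$ and $\nu$, respectively, the joint distribution functions $H_\mu$ of $\mu$ and $H_\nu$ of $\nu$ satisfy $$H_\mu(x_1,\dots,x_d)=\min\{F_1(x_1),\dots,F_d(x_d)\},\qquad H_\nu(y_1,\dots,y_d)=\min\{G_1(y_1),\dots,G_d(y_d)\}$$ for all $(x_1,\dots,x_d),(y_1,\dots,y_d)\in\mathbb{R}^d$. Then $$W_p^p(\mu,\nu)=\sum_{i=1}^d\int_{\mathbb{R}}\int_{\mathbb{R}}|x_i-y_i|^p\,dM(F_i(x_i),G_i(y_i)),$$ where $M(a,b)=\min\{a,b\}$ and $W_p$ is the Wasserstein distance of order $p$ on $(\mathbb{R}^d,\|\cdot\|_p)$.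
   Context: $\|x\|_p=(\sum_{i=1}^d|x_i|^p)^{1/p}$ is the $p$-norm on $\mathbb{R}^d$. $P_p(\mathbb{R}^d)$ is the set of Borel probability measures on $\mathbb{R}^d$ with finite moment of order $p$. The Wasserstein distance is defined by $W_p^p(\mu,\nu)=\inf_{\pi\in\Pi(\mu,\nu)}\int_{\mathbb{R}^d\times\mathbb{R}^d}\|x-y\|_p^p\,\pi(dx,dy)$, where $\Pi(\mu,\nu)$ is the set of all couplings, i.e. Borel probability measures on $\mathbb{R}^d\times\mathbb{R}^d$ with first marginal $\mu$ and second marginal $\nu$. Distribution functions are right-continuous: $H_\mu(x_1,\dots,x_d)=\mu((-\infty,x_1]\times\cdots\times(-\infty,x_d])$, and similarly for $H_\nu$ and the one-dimensional margins. The notation $dM(F_i(x_i),G_i(y_i))$ denotes integration with respect to the Borel probability measure on $\mathbb{R}^2$ whose joint distribution function is $(x,y)\mapsto\min\{F_i(x),G_i(y)\}$. *)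

theory Defs
  imports "HOL-Probability.Probability"
begin

definition pnorm :: "real \<Rightarrow> real ^ 'd \<Rightarrow> real" where
  "pnorm p x = (\<Sum>i\<in>UNIV. \<bar>x $ i\<bar> powr p) powr (1 / p)"

text \<open>Borel probability measures on \<open>\<real>\<^sup>d\<close> with finite moment of order \<open>p\<close>.\<close>

definition prob_measures_moment :: "real \<Rightarrow> (real ^ 'd) measure set" where
  "prob_measures_moment p =
    {\<mu>. prob_space \<mu> \<and> sets \<mu> = sets borel \<and> integrable \<mu> (\<lambda>x. pnorm p x powr p)}"

definition couplings :: "(real ^ 'd) measure \<Rightarrow> (real ^ 'd) measure \<Rightarrow>
    ((real ^ 'd) \<times> (real ^ 'd)) measure set" where
  "couplings \<mu> \<nu> = {\<pi>. prob_space \<pi> \<and> sets \<pi> = sets borel \<and>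
    distr \<pi> borel fst = \<mu> \<and> distr \<pi> borel snd = \<nu>}"

text \<open>
  The infimum is taken in the extended nonnegative reals, so that a coupling of infinite cost
  cannot contribute a spurious value; it is finite for measures with finite moment of order \<open>p\<close>,
  and only there is the conversion to a real number meaningful.
\<close>

definition wasserstein :: "real \<Rightarrow> (real ^ 'd) measure \<Rightarrow> (real ^ 'd) measure \<Rightarrow> real" where
  "wasserstein p \<mu> \<nu> =
    enn2real (INF \<pi>\<in>couplings \<mu> \<nu>. \<integral>\<^sup>+ z. ennreal (pnorm p (fst z - snd z) powr p) \<partial>\<pi>) powr (1 / p)"

definition joint_cdf :: "(real ^ 'd) measure \<Rightarrow> real ^ 'd \<Rightarrow> real" where
  "joint_cdf \<mu> x = measure \<mu> {z. \<forall>i. z $ i \<le> x $ i}"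

definition marginal_cdf :: "(real ^ 'd) measure \<Rightarrow> 'd \<Rightarrow> real \<Rightarrow> real" where
  "marginal_cdf \<mu> i = cdf (distr \<mu> borel (\<lambda>x. x $ i))"

definition has_comonotonicity_copula :: "(real ^ 'd) measure \<Rightarrow> bool" where
  "has_comonotonicity_copula \<mu> \<longleftrightarrow>
    (\<forall>x. joint_cdf \<mu> x = Min (range (\<lambda>i. marginal_cdf \<mu> i (x $ i))))"

text \<open>
  The Borel probability measure on \<open>\<real>\<^sup>2\<close> with joint distribution function \<open>H\<close>.  It is unique if it
  exists; the value is unspecified when \<open>H\<close> is not a joint distribution function.
\<close>

definition measure_of_joint_cdf :: "(real \<Rightarrow> real \<Rightarrow> real) \<Rightarrow> (real \<times> real) measure" where
  "measure_of_joint_cdf H = (THE \<kappa>. prob_space \<kappa> \<and> sets \<kappa> = sets borel \<and>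
    (\<forall>x y. measure \<kappa> ({..x} \<times> {..y}) = H x y))"

end

theory Submission
  imports Defs
begin

text \<open>
  The cost \<open>\<parallel>x - y\<parallel>\<^sub>p\<^sup>p\<close> splits over the coordinates, so every coupling costs at least the sum of the
  one-dimensional optimal costs.  A measure with the comonotonicity copula is the image of the uniform
  distribution on \<open>(0,1)\<close> under the vector of its marginal quantile functions; driving \<open>\<mu>\<close> and \<open>\<nu>\<close> by
  the same uniform variable gives a coupling that attains this bound in all coordinates at once.

  One-dimensional optimality of the quantile coupling is the pointwise bound
  \<open>\<kappa> ({..x} \<times> {..y}) \<le> min (F x) (G y)\<close> in integrated form:
  \<open>(x - y - t)\<^sup>+\<close> is the length of \<open>{s. y + t \<le> s < x}\<close>, and for \<open>p > 1\<close> the power \<open>z\<^sup>p\<close> is the mixture of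
  the hinges \<open>(z - t)\<^sup>+\<close> with density \<open>p (p - 1) t\<^sup>p\<^sup>-\<^sup>2\<close>.  All integrands are nonnegative, so Tonelli's
  theorem suffices and no integrability is needed.
\<close>

section \<open>Uniqueness of measures with a given joint distribution function\<close>

text \<open>Lower orthants are closed under intersection (take the \<open>inf\<close> of the
  corners), generate the Borel sets and exhaust the space. The type class covers both
  \<open>real \<times> real\<close> and \<open>real ^ 'd\<close>, where the lemma identifies laws of
  quantile maps.\<close>

lemma measure_eqI_atMost:
  fixes M N :: "'a::ordered_euclidean_space measure"
  assumes "finite_measure M" "finite_measure N"
    and sets: "sets M = sets borel" "sets N = sets borel"
    and eq: "\<And>a. measure M {..a} = measure N {..a}"
  shows "M = N"
proof (rule measure_eqI_generator_eq)
  interpret M: finite_measure M by fact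
  interpret N: finite_measure N by fact
  show "Int_stable (range (\<lambda>a::'a. {..a}))"
    by (auto simp: Int_stable_def intro: image_eqI[of _ _ "inf _ _"])
  show "sets M = sigma_sets UNIV (range (\<lambda>a. {..a}))"
    "sets N = sigma_sets UNIV (range (\<lambda>a. {..a}))"
    using sets by (simp_all add: borel_eq_atMost)
  show "emeasure M X = emeasure N X" if "X \<in> range (\<lambda>a. {..a})" for X
    using that eq by (auto simp: M.emeasure_eq_measure N.emeasure_eq_measure)
  show "(\<Union>i. {..real i *\<^sub>R (One::'a)}) = UNIV"
  proof safe
    fix x :: 'a
    obtain n where n: "norm x \<le> real n" using real_arch_simple by blast
    have "x \<bullet> b \<le> real n" if "b \<in> Basis" for b
      using Basis_le_norm[OF that, of x] n by linarith
    then have "x \<in> {..real n *\<^sub>R One}"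
      by (simp add: eucl_le[where 'a='a])
    then show "x \<in> (\<Union>i. {..real i *\<^sub>R (One::'a)})" by blast
  qed auto
qed (auto simp: finite_measure.emeasure_finite[OF assms(1)])

section \<open>Quantile functions on the uniform probability space\<close>

text \<open>The left-continuous generalized inverse of the distribution function. For
  \<open>u\<close> outside the open unit interval the infimum may be over an empty or unbounded set,
  hence the choice of \<open>unif\<close>.\<close>

definition quantile :: "real measure \<Rightarrow> real \<Rightarrow> real" where
  "quantile M u = Inf {x. u \<le> cdf M x}"

abbreviation unif :: "real measure" where
  "unif \<equiv> restrict_space lborel {0<..<1}"

lemma prob_space_unif: "prob_space unif"
  by (auto simp: emeasure_restrict_space space_restrict_space intro!: prob_spaceI)

lemma measure_unif_le:
  assumes "0 \<le> c" "c \<le> 1"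
  shows "measure unif {u. 0 < u \<and> u < 1 \<and> u \<le> c} = c"
proof -
  have "emeasure lborel {u. 0 < u \<and> u < 1 \<and> u \<le> c} = emeasure lborel {0<..<c}"
  proof (rule emeasure_eq_AE)
    \<comment> \<open>The two sets differ at most in the null point \<open>c\<close>; for
      \<open>c = 1\<close> they coincide.\<close>
    show "AE u in lborel. u \<in> {u. 0 < u \<and> u < 1 \<and> u \<le> c} \<longleftrightarrow> u \<in> {0<..<c}"
      using AE_lborel_singleton[of c] by eventually_elim (use assms in auto)
  qed auto
  then have "measure lborel {u. 0 < u \<and> u < 1 \<and> u \<le> c} = measure lborel {0<..<c}"
    by (simp only: measure_def)
  moreover have "measure unif {u. 0 < u \<and> u < 1 \<and> u \<le> c} = measure lborel {u. 0 < u \<and> u < 1 \<and> u \<le> c}"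
    by (subst measure_restrict_space) auto
  ultimately show ?thesis using assms by simp
qed

context real_distribution
begin

lemma cdf_distribution: "cdf_distribution M"
  using real_distribution_axioms by (simp add: cdf_distribution_def)

text \<open>Right continuity makes the infimum attained; the limits 0 and 1 make the set bounded
  below and nonempty. Events about quantiles thus become initial segments in
  \<open>u\<close>.\<close>

lemma quantile_le_iff: "0 < u \<Longrightarrow> u < 1 \<Longrightarrow> quantile M u \<le> x \<longleftrightarrow> u \<le> cdf M x"
  unfolding quantile_def
  by (metis right_continuous_mono.pseudoinverse right_continuous_mono.intro
      cdf_is_right_cont cdf_lim_at_top_prob cdf_lim_at_bot monoI cdf_nondecreasing)

lemma measurable_quantile: "quantile M \<in> borel_measurable unif"
  using cdf_distribution.measurable_CI[OF cdf_distribution]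
  by (simp add: quantile_def[abs_def] cong: measurable_cong_sets)

end

section \<open>Comparison of transport costs through hinge functions\<close>

text \<open>The hinge \<open>(x - y - t)\<^sup>+\<close> is encoded by \<^const>\<open>ennreal\<close>, which truncates negative reals to \<open>0\<close>.\<close>

lemma nn_integral_hinge:
  fixes \<kappa> :: "(real \<times> real) measure"
  assumes "finite_measure \<kappa>" and sets: "sets \<kappa> = sets borel"
  shows "(\<integral>\<^sup>+z. ennreal (fst z - snd z - t) \<partial>\<kappa>) =
    (\<integral>\<^sup>+s. emeasure \<kappa> {z. s < fst z \<and> snd z \<le> s - t} \<partial>lborel)"
proof -
  interpret finite_measure \<kappa> by fact
  interpret P: pair_sigma_finite \<kappa> "lborel :: real measure" ..
  have sp: "space \<kappa> = UNIV" using sets_eq_imp_space_eq[OF sets] by simp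
  have [measurable_cong]: "sets \<kappa> = sets (borel \<Otimes>\<^sub>M borel)" unfolding sets borel_prod ..
  have "(\<integral>\<^sup>+z. ennreal (fst z - snd z - t) \<partial>\<kappa>) =
      (\<integral>\<^sup>+z. \<integral>\<^sup>+s. (if s < fst z \<and> snd z \<le> s - t then 1 else 0) \<partial>lborel \<partial>\<kappa>)"
  proof (rule nn_integral_cong)
    fix z :: "real \<times> real"
    have "(\<integral>\<^sup>+s. (if s < fst z \<and> snd z \<le> s - t then 1 else 0) \<partial>lborel) =
        (\<integral>\<^sup>+s. indicator {snd z + t..<fst z} s \<partial>lborel)"
      by (intro nn_integral_cong) (auto simp: indicator_def)
    then show "ennreal (fst z - snd z - t) =
        (\<integral>\<^sup>+s. (if s < fst z \<and> snd z \<le> s - t then 1 else 0) \<partial>lborel)"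
      by (cases "snd z + t \<le> fst z") (simp_all add: ennreal_neg algebra_simps)
  qed
  also have "\<dots> = (\<integral>\<^sup>+s. \<integral>\<^sup>+z. (if s < fst z \<and> snd z \<le> s - t then 1 else 0) \<partial>\<kappa> \<partial>lborel)"
    by (rule P.Fubini'[symmetric]) measurable
  also have "\<dots> = (\<integral>\<^sup>+s. emeasure \<kappa> {z. s < fst z \<and> snd z \<le> s - t} \<partial>lborel)"
  proof (rule nn_integral_cong)
    fix s :: real
    have "{z \<in> space \<kappa>. s < fst z \<and> snd z \<le> s - t} \<in> sets \<kappa>" by measurable
    then have [measurable]: "{z. s < fst z \<and> snd z \<le> s - t} \<in> sets \<kappa>" by (simp add: sp)
    have "(\<integral>\<^sup>+z. (if s < fst z \<and> snd z \<le> s - t then 1 else 0) \<partial>\<kappa>) =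
        (\<integral>\<^sup>+z. indicator {z. s < fst z \<and> snd z \<le> s - t} z \<partial>\<kappa>)"
      by (intro nn_integral_cong) (auto simp: indicator_def)
    then show "(\<integral>\<^sup>+z. (if s < fst z \<and> snd z \<le> s - t then 1 else 0) \<partial>\<kappa>) =
        emeasure \<kappa> {z. s < fst z \<and> snd z \<le> s - t}" by simp
  qed
  finally show ?thesis .
qed

text \<open>The set in \<open>nn_integral_hinge\<close> is a strip minus a lower quadrant. Strips
  have equal mass by \<open>marg\<close>, so more mass in the quadrants means a smaller
  integral.\<close>

lemma nn_integral_hinge_mono:
  fixes \<kappa> \<kappa>' :: "(real \<times> real) measure"
  assumes fin: "finite_measure \<kappa>" "finite_measure \<kappa>'"
    and sets: "sets \<kappa> = sets borel" "sets \<kappa>' = sets borel"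
    and marg: "\<And>y. measure \<kappa> (UNIV \<times> {..y}) = measure \<kappa>' (UNIV \<times> {..y})"
    and le: "\<And>x y. measure \<kappa> ({..x} \<times> {..y}) \<le> measure \<kappa>' ({..x} \<times> {..y})"
  shows "(\<integral>\<^sup>+z. ennreal (fst z - snd z - t) \<partial>\<kappa>') \<le> (\<integral>\<^sup>+z. ennreal (fst z - snd z - t) \<partial>\<kappa>)"
proof -
  have eq: "emeasure K {z. s < fst z \<and> snd z \<le> s - t} =
      ennreal (measure K (UNIV \<times> {..s - t}) - measure K ({..s} \<times> {..s - t}))"
    if "finite_measure K" "sets K = sets borel" for K :: "(real \<times> real) measure" and s
  proof -
    interpret finite_measure K by fact
    have m: "UNIV \<times> {..s - t} \<in> sets K" "{..s} \<times> {..s - t} \<in> sets K"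
      unfolding that(2) borel_prod[symmetric] by (auto intro!: pair_measureI)
    \<comment> \<open>The strict first and weak second inequality make both sets in this difference
      closed, as the hypotheses on distribution functions require.\<close>
    have "{z. s < fst z \<and> snd z \<le> s - t} = UNIV \<times> {..s - t} - {..s} \<times> {..s - t}" by auto
    with m show ?thesis by (simp add: emeasure_eq_measure finite_measure_Diff Sigma_mono)
  qed
  show ?thesis
    unfolding nn_integral_hinge[OF fin(1) sets(1)] nn_integral_hinge[OF fin(2) sets(2)]
      eq[OF fin(1) sets(1)] eq[OF fin(2) sets(2)]
    by (intro nn_integral_mono ennreal_leI diff_mono) (simp_all add: marg le)
qed

text \<open>Taylor's formula at 0 with integral remainder: the weight is the second derivative of
  the power. For \<open>p < 2\<close> it is singular at 0 but still integrable, as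
  \<open>p - 2 > -1\<close>.\<close>

lemma powr_eq_nn_integral_hinge:
  assumes p: "1 < p"
  shows "ennreal (max 0 z powr p) =
    (\<integral>\<^sup>+t. ennreal (p * (p - 1) * t powr (p - 2)) * indicator {0..} t * ennreal (z - t) \<partial>lborel)"
proof (cases "0 < z")
  case True
  let ?f = "\<lambda>t. p * (p - 1) * (z * t powr (p - 2) - t powr (p - 1))"
  have "(?f has_integral p * (p - 1) * (z * (z powr (p - 2 + 1) / (p - 2 + 1)) - z powr (p - 1 + 1) / (p - 1 + 1))) {0..z}"
    using p True by (intro has_integral_mult_right has_integral_diff has_integral_powr_from_0) auto
  also have "p * (p - 1) * (z * (z powr (p - 2 + 1) / (p - 2 + 1)) - z powr (p - 1 + 1) / (p - 1 + 1)) = z powr p"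
    using p True powr_mult_base[of z "p - 1"] by (simp add: field_simps)
  finally have "((\<lambda>t. if t \<in> {0..z} then ?f t else 0) has_integral z powr p) UNIV"
    by (subst has_integral_restrict_UNIV)
  \<comment> \<open>This holds at \<open>t = 0\<close> too, since \<open>0 powr a = 0\<close> for
    every \<open>a\<close>.\<close>
  moreover have f: "?f t = p * (p - 1) * t powr (p - 2) * (z - t)" if "0 \<le> t" for t
    using that powr_mult_base[of t "p - 2"] by (simp add: algebra_simps)
  ultimately have "integral\<^sup>N lborel (\<lambda>t. ennreal (if t \<in> {0..z} then ?f t else 0)) = ennreal (z powr p)"
    using p by (intro nn_integral_has_integral_lborel) auto
  then have "ennreal (z powr p) = (\<integral>\<^sup>+t. ennreal (if t \<in> {0..z} then ?f t else 0) \<partial>lborel)" by simp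
  \<comment> \<open>Beyond \<open>z\<close> the hinge is truncated to 0, so the integral over the
    half-line sees only \<open>{0..z}\<close>.\<close>
  also have "\<dots> = (\<integral>\<^sup>+t. ennreal (p * (p - 1) * t powr (p - 2)) * indicator {0..} t * ennreal (z - t) \<partial>lborel)"
    using p by (intro nn_integral_cong) (auto simp: f ennreal_mult'[symmetric] ennreal_neg indicator_def)
  finally show ?thesis using True by (simp add: max_def)
next
  case False
  then have "(\<integral>\<^sup>+t. ennreal (p * (p - 1) * t powr (p - 2)) * indicator {0..} t * ennreal (z - t) \<partial>lborel) = 0"
    by (intro nn_integral_0_iff_AE[THEN iffD2] AE_I2) (auto simp: indicator_def ennreal_neg)
  with False show ?thesis by (simp add: max_def)
qed


text \<open>Integrate the hinge comparison against the mixing weight. At \<open>p = 1\<close> this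
  weight vanishes, but there the positive part is itself the hinge with
  \<open>t = 0\<close>.\<close>

lemma nn_integral_powr_pos_part_mono:
  fixes \<kappa> \<kappa>' :: "(real \<times> real) measure"
  assumes p: "1 \<le> p"
    and fin: "finite_measure \<kappa>" "finite_measure \<kappa>'"
    and sets: "sets \<kappa> = sets borel" "sets \<kappa>' = sets borel"
    and marg: "\<And>y. measure \<kappa> (UNIV \<times> {..y}) = measure \<kappa>' (UNIV \<times> {..y})"
    and le: "\<And>x y. measure \<kappa> ({..x} \<times> {..y}) \<le> measure \<kappa>' ({..x} \<times> {..y})"
  shows "(\<integral>\<^sup>+z. ennreal (max 0 (fst z - snd z) powr p) \<partial>\<kappa>') \<le>
    (\<integral>\<^sup>+z. ennreal (max 0 (fst z - snd z) powr p) \<partial>\<kappa>)"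
proof (cases "p = 1")
  case True
  then show ?thesis
    using nn_integral_hinge_mono[OF fin sets marg le, of 0] by (simp add: ennreal_max_0)
next
  case False
  with p have p: "1 < p" by simp
  let ?w = "\<lambda>t. ennreal (p * (p - 1) * t powr (p - 2)) * indicator {0..} t"
  have eq: "(\<integral>\<^sup>+z. ennreal (max 0 (fst z - snd z) powr p) \<partial>K) =
      (\<integral>\<^sup>+t. ?w t * (\<integral>\<^sup>+z. ennreal (fst z - snd z - t) \<partial>K) \<partial>lborel)"
    if "finite_measure K" "sets K = sets borel" for K :: "(real \<times> real) measure"
  proof -
    interpret finite_measure K by fact
    interpret P: pair_sigma_finite K "lborel :: real measure" ..
    have [measurable_cong]: "sets K = sets (borel \<Otimes>\<^sub>M borel)" unfolding that borel_prod ..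
    have "(\<integral>\<^sup>+z. ennreal (max 0 (fst z - snd z) powr p) \<partial>K) =
        (\<integral>\<^sup>+z. \<integral>\<^sup>+t. ?w t * ennreal (fst z - snd z - t) \<partial>lborel \<partial>K)"
      by (simp add: powr_eq_nn_integral_hinge[OF p])
    also have "\<dots> = (\<integral>\<^sup>+t. \<integral>\<^sup>+z. ?w t * ennreal (fst z - snd z - t) \<partial>K \<partial>lborel)"
      by (rule P.Fubini'[symmetric]) measurable
    also have "\<dots> = (\<integral>\<^sup>+t. ?w t * (\<integral>\<^sup>+z. ennreal (fst z - snd z - t) \<partial>K) \<partial>lborel)"
      by (intro nn_integral_cong nn_integral_cmult) measurable
    finally show ?thesis .
  qed
  show ?thesis
    unfolding eq[OF fin(1) sets(1)] eq[OF fin(2) sets(2)]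
    by (intro nn_integral_mono mult_left_mono nn_integral_hinge_mono fin sets marg le) simp
qed

text \<open>The absolute power is the sum of the powers of the positive parts of
  \<open>x - y\<close> and \<open>y - x\<close>. The latter is the former for the swapped measure,
  where the first margins take over the role of the second.\<close>

lemma nn_integral_powr_dist_mono:
  fixes \<kappa> \<kappa>' :: "(real \<times> real) measure"
  assumes p: "1 \<le> p"
    and fin: "finite_measure \<kappa>" "finite_measure \<kappa>'"
    and sets: "sets \<kappa> = sets borel" "sets \<kappa>' = sets borel"
    and marg: "\<And>x. measure \<kappa> ({..x} \<times> UNIV) = measure \<kappa>' ({..x} \<times> UNIV)"
      "\<And>y. measure \<kappa> (UNIV \<times> {..y}) = measure \<kappa>' (UNIV \<times> {..y})"
    and le: "\<And>x y. measure \<kappa> ({..x} \<times> {..y}) \<le> measure \<kappa>' ({..x} \<times> {..y})"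
  shows "(\<integral>\<^sup>+z. ennreal (\<bar>fst z - snd z\<bar> powr p) \<partial>\<kappa>') \<le>
    (\<integral>\<^sup>+z. ennreal (\<bar>fst z - snd z\<bar> powr p) \<partial>\<kappa>)"
proof -
  let ?s = "\<lambda>z::real \<times> real. (snd z, fst z)"
  have K: "(\<integral>\<^sup>+z. ennreal (\<bar>fst z - snd z\<bar> powr p) \<partial>K) =
      (\<integral>\<^sup>+z. ennreal (max 0 (fst z - snd z) powr p) \<partial>K) +
      (\<integral>\<^sup>+z. ennreal (max 0 (fst z - snd z) powr p) \<partial>distr K borel ?s)" (is ?abs)
    "finite_measure (distr K borel ?s)" (is ?fin)
    "\<forall>A\<in>sets borel. \<forall>B\<in>sets borel. measure (distr K borel ?s) (A \<times> B) = measure K (B \<times> A)" (is ?swap)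
    if "finite_measure K" and sets: "sets K = sets borel" for K :: "(real \<times> real) measure"
  proof -
    interpret finite_measure K by fact
    have [measurable_cong]: "sets K = sets (borel \<Otimes>\<^sub>M borel)" unfolding sets borel_prod ..
    have sp: "space K = UNIV" using sets_eq_imp_space_eq[OF sets] by simp
    have s[measurable]: "?s \<in> K \<rightarrow>\<^sub>M borel" unfolding borel_prod[symmetric] by measurable
    have "(\<integral>\<^sup>+z. ennreal (max 0 (fst z - snd z) powr p) \<partial>distr K borel ?s) =
        (\<integral>\<^sup>+z. ennreal (max 0 (snd z - fst z) powr p) \<partial>K)"
      by (subst nn_integral_distr) (auto simp: borel_prod[symmetric])
    moreover have "(\<integral>\<^sup>+z. ennreal (\<bar>fst z - snd z\<bar> powr p) \<partial>K) =
      (\<integral>\<^sup>+z. ennreal (max 0 (fst z - snd z) powr p) + ennreal (max 0 (snd z - fst z) powr p) \<partial>K)"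
      using p by (intro nn_integral_cong) (auto simp: max_def abs_if)
    ultimately show ?abs
      by (simp add: nn_integral_add)
    show ?fin by (rule finite_measure_distr) fact
    show ?swap
    proof (intro ballI)
      fix A B :: "real set" assume "A \<in> sets borel" "B \<in> sets borel"
      then have "A \<times> B \<in> sets borel" unfolding borel_prod[symmetric] by simp
      then show "measure (distr K borel ?s) (A \<times> B) = measure K (B \<times> A)"
        by (subst measure_distr) (auto simp: sp intro!: arg_cong[where f="measure K"])
    qed
  qed
  show ?thesis
    unfolding K(1)[OF fin(1) sets(1)] K(1)[OF fin(2) sets(2)]
    by (intro add_mono nn_integral_powr_pos_part_mono p fin sets K(2))
      (simp_all add: K(3) fin sets marg le)
qed

section \<open>One-dimensional optimality of the quantile coupling\<close>

text \<open>One \<open>u\<close> drives both coordinates, so both quantile conditions together say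
  that \<open>u\<close> is below both distribution function values.\<close>

lemma measure_quantile_coupling:
  assumes M: "real_distribution M" and N: "real_distribution N"
  shows "measure (distr unif borel (\<lambda>u. (quantile M u, quantile N u))) ({..x} \<times> {..y}) =
    min (cdf M x) (cdf N y)"
proof -
  interpret M: real_distribution M by fact
  interpret N: real_distribution N by fact
  have [measurable]: "(\<lambda>u. (quantile M u, quantile N u)) \<in> unif \<rightarrow>\<^sub>M borel"
    unfolding borel_prod[symmetric]
    by (intro measurable_Pair M.measurable_quantile N.measurable_quantile)
  have "{..x} \<times> {..y} \<in> sets borel" unfolding borel_prod[symmetric] by simp
  then have "measure (distr unif borel (\<lambda>u. (quantile M u, quantile N u))) ({..x} \<times> {..y}) =
      measure unif {u. 0 < u \<and> u < 1 \<and> u \<le> min (cdf M x) (cdf N y)}"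
    by (subst measure_distr)
      (auto simp: space_restrict_space M.quantile_le_iff N.quantile_le_iff intro!: arg_cong[where f="measure unif"])
  also have "\<dots> = min (cdf M x) (cdf N y)"
    by (rule measure_unif_le) (auto simp: M.cdf_nonneg N.cdf_nonneg M.cdf_bounded_prob min_le_iff_disj)
  finally show ?thesis .
qed

lemma distr_unif_quantile:
  assumes "real_distribution M"
  shows "distr unif borel (quantile M) = M"
  using cdf_distribution.distr_I_eq_M[OF real_distribution.cdf_distribution[OF assms]]
  by (simp add: quantile_def[abs_def])

text \<open>Resolves the definite description: in the product order lower orthants are exactly these
  rectangles, so uniqueness is \<open>measure_eqI_atMost\<close>.\<close>

lemma measure_of_joint_cdf_eqI:
  assumes "prob_space \<kappa>" "sets \<kappa> = sets borel"
    and "\<And>x y. measure \<kappa> ({..x} \<times> {..y}) = H x y"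
  shows "measure_of_joint_cdf H = \<kappa>"
  unfolding measure_of_joint_cdf_def
proof (rule the_equality)
  fix K :: "(real \<times> real) measure"
  assume K: "prob_space K \<and> sets K = sets borel \<and> (\<forall>x y. measure K ({..x} \<times> {..y}) = H x y)"
  have "measure K {..a} = measure \<kappa> {..a}" for a
  proof -
    have "{..a} = {..fst a} \<times> {..snd a}" by (auto simp: less_eq_prod_def)
    then show ?thesis using K assms(3) by simp
  qed
  then show "K = \<kappa>"
    using K assms by (intro measure_eqI_atMost) (auto intro: prob_space.finite_measure)
qed (use assms in auto)

text \<open>The Frechet-Hoeffding upper bound: each joint distribution function is at most the
  minimum of its margins, and the quantile coupling of the same margins attains that
  minimum.\<close>

lemma nn_integral_quantile_coupling_le:
  fixes \<kappa> :: "(real \<times> real) measure"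
  assumes p: "1 \<le> p" and \<kappa>: "prob_space \<kappa>" "sets \<kappa> = sets borel"
  defines "M \<equiv> distr \<kappa> borel fst" and "N \<equiv> distr \<kappa> borel snd"
  shows "(\<integral>\<^sup>+u. ennreal (\<bar>quantile M u - quantile N u\<bar> powr p) \<partial>unif) \<le>
    (\<integral>\<^sup>+z. ennreal (\<bar>fst z - snd z\<bar> powr p) \<partial>\<kappa>)"
proof -
  interpret prob_space \<kappa> by fact
  interpret unif: prob_space unif by (rule prob_space_unif)
  have [measurable_cong]: "sets \<kappa> = sets (borel \<Otimes>\<^sub>M borel)" unfolding \<kappa> borel_prod ..
  have sp: "space \<kappa> = UNIV" using sets_eq_imp_space_eq[OF \<kappa>(2)] by simp
  have M: "real_distribution M" and N: "real_distribution N"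
    unfolding M_def N_def by (intro real_distribution_distr; measurable)+
  let ?q = "\<lambda>u. (quantile M u, quantile N u)"
  have qM[measurable]: "quantile M \<in> borel_measurable unif" and qN[measurable]: "quantile N \<in> borel_measurable unif"
    using M N by (simp_all add: real_distribution.measurable_quantile)
  have q[measurable]: "?q \<in> unif \<rightarrow>\<^sub>M borel" unfolding borel_prod[symmetric] by measurable
  have cdf: "cdf M x = measure \<kappa> ({..x} \<times> UNIV)" "cdf N x = measure \<kappa> (UNIV \<times> {..x})" for x
    unfolding M_def N_def cdf_def
    by (subst measure_distr; auto simp: sp intro!: arg_cong[where f="measure \<kappa>"])+
  \<comment> \<open>Rectangles with a full side lie outside
    \<open>measure_quantile_coupling\<close>; here the law of each single quantile function gives
    the margin.\<close>
  have cdf': "cdf M x = measure (distr unif borel ?q) ({..x} \<times> UNIV)"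
    "cdf N x = measure (distr unif borel ?q) (UNIV \<times> {..x})" for x
  proof -
    have s: "{..x} \<times> (UNIV :: real set) \<in> sets borel" "(UNIV :: real set) \<times> {..x} \<in> sets borel"
      unfolding borel_prod[symmetric] by simp_all
    show "cdf M x = measure (distr unif borel ?q) ({..x} \<times> UNIV)"
      by (subst distr_unif_quantile[OF M, symmetric])
        (auto simp: cdf_def measure_distr s intro!: arg_cong[where f="measure unif"])
    show "cdf N x = measure (distr unif borel ?q) (UNIV \<times> {..x})"
      by (subst distr_unif_quantile[OF N, symmetric])
        (auto simp: cdf_def measure_distr s intro!: arg_cong[where f="measure unif"])
  qed
  have le: "measure \<kappa> ({..x} \<times> {..y}) \<le> cdf M x" "measure \<kappa> ({..x} \<times> {..y}) \<le> cdf N y" for x y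
    unfolding cdf by (intro finite_measure_mono; auto)+
  have "(\<integral>\<^sup>+u. ennreal (\<bar>quantile M u - quantile N u\<bar> powr p) \<partial>unif) =
      (\<integral>\<^sup>+z. ennreal (\<bar>fst z - snd z\<bar> powr p) \<partial>distr unif borel ?q)"
    by (subst nn_integral_distr) (auto simp: borel_prod[symmetric])
  also have "\<dots> \<le> (\<integral>\<^sup>+z. ennreal (\<bar>fst z - snd z\<bar> powr p) \<partial>\<kappa>)"
    by (intro nn_integral_powr_dist_mono p \<kappa> unif.finite_measure_distr q finite_measure_axioms)
      (simp_all add: cdf[symmetric] cdf'[symmetric] measure_quantile_coupling[OF M N] le)
  finally show ?thesis .
qed


section \<open>Coordinates and comonotone measures in higher dimension\<close>

lemma pnorm_powr: "p > 0 \<Longrightarrow> pnorm p x powr p = (\<Sum>i\<in>UNIV. \<bar>x $ i\<bar> powr p)"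
  by (simp add: pnorm_def powr_powr sum_nonneg)

lemma measurable_vec_lambda:
  fixes f :: "'a \<Rightarrow> 'd::finite \<Rightarrow> real"
  assumes "\<And>i. (\<lambda>x. f x i) \<in> borel_measurable M"
  shows "(\<lambda>x. \<chi> i. f x i) \<in> borel_measurable M"
  using assms by (subst borel_measurable_euclidean_space) (auto simp: Basis_vec_def inner_axis)

lemma measurable_vec_nth': "(\<lambda>x::real ^ 'd. x $ i) \<in> borel_measurable borel"
  by (intro borel_measurable_continuous_onI continuous_intros)

lemma real_distribution_marginal:
  fixes \<mu> :: "(real ^ 'd) measure"
  assumes "prob_space \<mu>" "sets \<mu> = sets borel"
  shows "real_distribution (distr \<mu> borel (\<lambda>x. x $ i))"
  using measurable_vec_nth'[of i] assms
  by (intro prob_space.real_distribution_distr) (simp_all cong: measurable_cong_sets)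

definition comonotone_rearrangement :: "(real ^ 'd) measure \<Rightarrow> real \<Rightarrow> real ^ 'd" where
  "comonotone_rearrangement \<mu> u = (\<chi> i. quantile (distr \<mu> borel (\<lambda>x. x $ i)) u)"

lemma measurable_comonotone_rearrangement:
  assumes "prob_space \<mu>" "sets \<mu> = sets borel"
  shows "comonotone_rearrangement \<mu> \<in> borel_measurable unif"
  unfolding comonotone_rearrangement_def[abs_def]
  by (intro measurable_vec_lambda real_distribution.measurable_quantile
      real_distribution_marginal assms)

text \<open>All coordinates share one \<open>u\<close>, so the orthant condition reads
  \<open>u \<le> ?m\<close>. This event has probability \<open>?m\<close>, which the copula
  hypothesis equates with the joint distribution function.\<close>

lemma distr_comonotone_rearrangement:
  fixes \<mu> :: "(real ^ 'd) measure"
  assumes \<mu>: "prob_space \<mu>" "sets \<mu> = sets borel" and "has_comonotonicity_copula \<mu>"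
  shows "distr unif borel (comonotone_rearrangement \<mu>) = \<mu>"
proof (rule measure_eqI_atMost)
  note T = measurable_comonotone_rearrangement[OF \<mu>]
  interpret D: real_distribution "distr \<mu> borel (\<lambda>x. x $ i)" for i
    by (rule real_distribution_marginal[OF \<mu>])
  show "finite_measure (distr unif borel (comonotone_rearrangement \<mu>))"
    using prob_space_unif T by (intro prob_space.finite_measure prob_space.prob_space_distr)
  fix a :: "real ^ 'd"
  let ?F = "\<lambda>i. marginal_cdf \<mu> i (a $ i)"
  let ?m = "Min (range ?F)"
  have "measure (distr unif borel (comonotone_rearrangement \<mu>)) {..a} =
      measure unif {u. 0 < u \<and> u < 1 \<and> u \<le> ?m}"
    by (subst measure_distr[OF T])
      (auto simp: space_restrict_space less_eq_vec_def comonotone_rearrangement_def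
        D.quantile_le_iff marginal_cdf_def intro!: arg_cong[where f="measure unif"])
  also have "\<dots> = ?m"
  proof (rule measure_unif_le)
    show "0 \<le> ?m" by (auto simp: marginal_cdf_def D.cdf_nonneg)
    \<comment> \<open>\<open>undefined\<close> is just some index; any coordinate bounds the
      minimum.\<close>
    have "?m \<le> ?F undefined" by (rule Min_le) auto
    also have "\<dots> \<le> 1" by (simp add: marginal_cdf_def D.cdf_bounded_prob)
    finally show "?m \<le> 1" .
  qed
  also have "\<dots> = measure \<mu> {..a}"
    using assms(3) by (simp add: has_comonotonicity_copula_def joint_cdf_def atMost_def less_eq_vec_def)
  finally show "measure (distr unif borel (comonotone_rearrangement \<mu>)) {..a} = measure \<mu> {..a}" .
qed (use \<mu> in \<open>auto intro: prob_space.finite_measure\<close>)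

lemma nn_integral_pnorm_diff:
  fixes f g :: "'a \<Rightarrow> real ^ 'd"
  assumes "p > 0" "f \<in> borel_measurable M" "g \<in> borel_measurable M"
  shows "(\<integral>\<^sup>+x. ennreal (pnorm p (f x - g x) powr p) \<partial>M) =
    (\<Sum>i\<in>UNIV. \<integral>\<^sup>+x. ennreal (\<bar>f x $ i - g x $ i\<bar> powr p) \<partial>M)"
proof -
  have [measurable]: "(\<lambda>x. f x $ i) \<in> borel_measurable M" "(\<lambda>x. g x $ i) \<in> borel_measurable M" for i
    using assms(2,3) measurable_vec_nth'[of i] by (auto intro: measurable_compose)
  show ?thesis
    by (subst nn_integral_sum[symmetric]) (simp_all add: pnorm_powr assms(1))
qed

section \<open>Finiteness and lower bound for coupling costs\<close>

text \<open>From \<open>\<bar>a - b\<bar>\<close> being at most twice the larger absolute value; the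
  crude constant suffices for finiteness.\<close>

lemma powr_abs_diff_le:
  fixes a b p :: real
  assumes "p \<ge> 0"
  shows "\<bar>a - b\<bar> powr p \<le> 2 powr p * (\<bar>a\<bar> powr p + \<bar>b\<bar> powr p)"
proof -
  have "\<bar>a - b\<bar> powr p \<le> (2 * max \<bar>a\<bar> \<bar>b\<bar>) powr p"
    using assms by (intro powr_mono2) auto
  also have "\<dots> = 2 powr p * (max \<bar>a\<bar> \<bar>b\<bar>) powr p" by (simp add: powr_mult)
  also have "\<dots> \<le> 2 powr p * (\<bar>a\<bar> powr p + \<bar>b\<bar> powr p)"
    by (intro mult_left_mono) (auto simp: max_def)
  finally show ?thesis .
qed

lemma pnorm_diff_powr_le:
  "p > 0 \<Longrightarrow> pnorm p (x - y) powr p \<le> 2 powr p * (pnorm p x powr p + pnorm p y powr p)"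
  by (simp add: pnorm_powr sum_distrib_left sum.distrib[symmetric] powr_abs_diff_le sum_mono)

text \<open>The margins of the coupling carry the moments. Finiteness matters because
  \<open>enn2real\<close> in \<open>wasserstein\<close> would send an infinite infimum to 0.\<close>

lemma coupling_cost_finite:
  fixes \<mu> \<nu> :: "(real ^ 'd) measure"
  assumes p: "p > 0" and \<mu>: "\<mu> \<in> prob_measures_moment p" and \<nu>: "\<nu> \<in> prob_measures_moment p"
    and \<pi>: "\<pi> \<in> couplings \<mu> \<nu>"
  shows "(\<integral>\<^sup>+z. ennreal (pnorm p (fst z - snd z) powr p) \<partial>\<pi>) < \<top>"
proof -
  have [measurable_cong]: "sets \<pi> = sets (borel \<Otimes>\<^sub>M borel)"
    using \<pi> unfolding borel_prod by (simp add: couplings_def)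
  have "(\<lambda>x::real ^ 'd. pnorm p x powr p) \<in> borel_measurable borel"
    using measurable_vec_nth' by (simp add: pnorm_powr p)
  note [measurable] = this
  have "integrable (distr \<pi> borel fst) (\<lambda>x. pnorm p x powr p)"
    "integrable (distr \<pi> borel snd) (\<lambda>x. pnorm p x powr p)"
    using \<mu> \<nu> \<pi> by (auto simp: couplings_def prob_measures_moment_def)
  then have "integrable \<pi> (\<lambda>z. pnorm p (fst z) powr p)" "integrable \<pi> (\<lambda>z. pnorm p (snd z) powr p)"
    by (auto dest!: integrable_distr[rotated])
  then have "integrable \<pi> (\<lambda>z. 2 powr p * (pnorm p (fst z) powr p + pnorm p (snd z) powr p))"
    by simp
  from integrableD(2)[OF this]
  have "(\<integral>\<^sup>+z. ennreal (2 powr p * (pnorm p (fst z) powr p + pnorm p (snd z) powr p)) \<partial>\<pi>) < \<top>"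
    by (simp add: abs_mult less_top)
  moreover have "(\<integral>\<^sup>+z. ennreal (pnorm p (fst z - snd z) powr p) \<partial>\<pi>) \<le>
      (\<integral>\<^sup>+z. ennreal (2 powr p * (pnorm p (fst z) powr p + pnorm p (snd z) powr p)) \<partial>\<pi>)"
    by (intro nn_integral_mono ennreal_leI pnorm_diff_powr_le p)
  ultimately show ?thesis by (rule le_less_trans[rotated])
qed

text \<open>The cost is a sum over coordinates, and projecting \<open>\<pi>\<close> to its pair of
  i-th coordinates couples the i-th margins, so one-dimensional optimality applies to each
  summand.\<close>

lemma sum_quantile_cost_le_coupling_cost:
  fixes \<mu> \<nu> :: "(real ^ 'd) measure"
  assumes p: "1 \<le> p" and \<pi>: "\<pi> \<in> couplings \<mu> \<nu>"
  shows "(\<Sum>i\<in>UNIV. \<integral>\<^sup>+u. ennreal (\<bar>quantile (distr \<mu> borel (\<lambda>x. x $ i)) u -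
      quantile (distr \<nu> borel (\<lambda>x. x $ i)) u\<bar> powr p) \<partial>unif) \<le>
    (\<integral>\<^sup>+z. ennreal (pnorm p (fst z - snd z) powr p) \<partial>\<pi>)"
proof -
  have sets: "sets \<pi> = sets (borel \<Otimes>\<^sub>M borel)"
    using \<pi> unfolding borel_prod by (simp add: couplings_def)
  note [measurable_cong] = sets
  note [measurable] = measurable_vec_nth'
  from \<pi> have marg: "distr \<pi> borel fst = \<mu>" "distr \<pi> borel snd = \<nu>"
    and "prob_space \<pi>" by (simp_all add: couplings_def)
  interpret prob_space \<pi> by fact
  have "(\<integral>\<^sup>+u. ennreal (\<bar>quantile (distr \<mu> borel (\<lambda>x. x $ i)) u -
      quantile (distr \<nu> borel (\<lambda>x. x $ i)) u\<bar> powr p) \<partial>unif) \<le>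
      (\<integral>\<^sup>+z. ennreal (\<bar>fst z $ i - snd z $ i\<bar> powr p) \<partial>\<pi>)" (is "?L \<le> ?R") for i
  proof -
    let ?h = "\<lambda>z::(real ^ 'd) \<times> (real ^ 'd). (fst z $ i, snd z $ i)"
    have h[measurable]: "?h \<in> \<pi> \<rightarrow>\<^sub>M borel" unfolding borel_prod[symmetric] by measurable
    have d: "distr (distr \<pi> borel ?h) borel fst = distr \<mu> borel (\<lambda>x. x $ i)"
      "distr (distr \<pi> borel ?h) borel snd = distr \<nu> borel (\<lambda>x. x $ i)"
      unfolding marg[symmetric]
      by (subst (1 2) distr_distr; simp add: comp_def borel_prod[symmetric])+
    have "?L \<le> (\<integral>\<^sup>+z. ennreal (\<bar>fst z - snd z\<bar> powr p) \<partial>distr \<pi> borel ?h)"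
      using nn_integral_quantile_coupling_le[OF p prob_space_distr[OF h]] by (simp add: d)
    also have "\<dots> = ?R"
      by (subst nn_integral_distr) (auto simp: borel_prod[symmetric])
    finally show ?thesis .
  qed
  then have "(\<Sum>i\<in>UNIV. \<integral>\<^sup>+u. ennreal (\<bar>quantile (distr \<mu> borel (\<lambda>x. x $ i)) u -
      quantile (distr \<nu> borel (\<lambda>x. x $ i)) u\<bar> powr p) \<partial>unif) \<le>
    (\<Sum>i\<in>UNIV. \<integral>\<^sup>+z. ennreal (\<bar>fst z $ i - snd z $ i\<bar> powr p) \<partial>\<pi>)"
    by (rule sum_mono)
  also have "\<dots> = (\<integral>\<^sup>+z. ennreal (pnorm p (fst z - snd z) powr p) \<partial>\<pi>)"
    using p by (subst nn_integral_pnorm_diff) measurable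
  finally show ?thesis .
qed

section \<open>The optimal coupling and the Wasserstein formula\<close>

theorem proposition2p5:
  fixes p :: real and \<mu> \<nu> :: "(real ^ 'd) measure"
  assumes "CARD('d) > 1"
    and "p \<ge> 1"
    and "\<mu> \<in> prob_measures_moment p"
    and "\<nu> \<in> prob_measures_moment p"
    and "has_comonotonicity_copula \<mu>"
    and "has_comonotonicity_copula \<nu>"
  shows "ennreal (wasserstein p \<mu> \<nu> powr p) =
    (\<Sum>i\<in>UNIV. \<integral>\<^sup>+ z. ennreal (\<bar>fst z - snd z\<bar> powr p)
      \<partial>measure_of_joint_cdf (\<lambda>x y. min (marginal_cdf \<mu> i x) (marginal_cdf \<nu> i y)))"
proof -
  from assms have \<mu>: "prob_space \<mu>" "sets \<mu> = sets borel" and \<nu>: "prob_space \<nu>" "sets \<nu> = sets borel"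
    by (simp_all add: prob_measures_moment_def)
  interpret unif: prob_space unif by (rule prob_space_unif)
  define M where "M i = distr \<mu> borel (\<lambda>x. x $ i)" for i
  define N where "N i = distr \<nu> borel (\<lambda>x. x $ i)" for i
  define S where "S = (\<Sum>i\<in>UNIV. \<integral>\<^sup>+u. ennreal (\<bar>quantile (M i) u - quantile (N i) u\<bar> powr p) \<partial>unif)"
  define cost where "cost \<pi> = (\<integral>\<^sup>+z. ennreal (pnorm p (fst z - snd z) powr p) \<partial>\<pi>)"
    for \<pi> :: "((real ^ 'd) \<times> (real ^ 'd)) measure"
  have M: "real_distribution (M i)" and N: "real_distribution (N i)" for i
    unfolding M_def N_def by (intro real_distribution_marginal \<mu> \<nu>)+

  let ?T = "\<lambda>u. (comonotone_rearrangement \<mu> u, comonotone_rearrangement \<nu> u)"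
  note [measurable] = measurable_comonotone_rearrangement[OF \<mu>] measurable_comonotone_rearrangement[OF \<nu>]
    measurable_vec_nth'
  have T[measurable]: "?T \<in> unif \<rightarrow>\<^sub>M borel" unfolding borel_prod[symmetric] by measurable
  \<comment> \<open>The same \<open>u\<close> drives all coordinates of both vectors, so each
    coordinate pair is its one-dimensional quantile coupling.\<close>
  let ?\<pi> = "distr unif borel ?T"
  have coupling: "?\<pi> \<in> couplings \<mu> \<nu>"
  proof -
    have "distr ?\<pi> borel fst = \<mu>" "distr ?\<pi> borel snd = \<nu>"
      using distr_comonotone_rearrangement[OF \<mu> assms(5)] distr_comonotone_rearrangement[OF \<nu> assms(6)]
      by (subst distr_distr; simp add: comp_def borel_prod[symmetric])+
    then show ?thesis using T by (simp add: couplings_def unif.prob_space_distr)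
  qed
  have "cost ?\<pi> = (\<integral>\<^sup>+u. ennreal (pnorm p (comonotone_rearrangement \<mu> u - comonotone_rearrangement \<nu> u) powr p) \<partial>unif)"
    using assms(2) unfolding cost_def
    by (subst nn_integral_distr) (auto simp: borel_prod[symmetric] pnorm_powr)
  also have "\<dots> = S"
    using assms(2) by (subst nn_integral_pnorm_diff) (auto simp: comonotone_rearrangement_def S_def M_def N_def)
  finally have cost: "cost ?\<pi> = S" .
  have "(INF \<pi>\<in>couplings \<mu> \<nu>. cost \<pi>) = S"
  proof (rule antisym)
    show "(INF \<pi>\<in>couplings \<mu> \<nu>. cost \<pi>) \<le> S"
      unfolding cost[symmetric] by (rule INF_lower[OF coupling])
    show "S \<le> (INF \<pi>\<in>couplings \<mu> \<nu>. cost \<pi>)"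
      unfolding S_def cost_def M_def N_def
      by (intro INF_greatest sum_quantile_cost_le_coupling_cost assms)
  qed
  \<comment> \<open>Finiteness makes \<open>enn2real\<close> faithful, and the exponents
    \<open>1 / p\<close> and \<open>p\<close> then cancel.\<close>
  moreover have "S < \<top>"
    using coupling_cost_finite[OF _ assms(3,4) coupling] assms(2) by (simp flip: cost add: cost_def)
  ultimately have "ennreal (wasserstein p \<mu> \<nu> powr p) = S"
    using assms(2) unfolding wasserstein_def cost_def[symmetric] by (simp add: powr_powr)
  also have "S = (\<Sum>i\<in>UNIV. \<integral>\<^sup>+ z. ennreal (\<bar>fst z - snd z\<bar> powr p)
      \<partial>measure_of_joint_cdf (\<lambda>x y. min (marginal_cdf \<mu> i x) (marginal_cdf \<nu> i y)))"
    unfolding S_def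
  proof (rule sum.cong)
    fix i :: 'd
    let ?q = "\<lambda>u. (quantile (M i) u, quantile (N i) u)"
    have [measurable]: "quantile (M i) \<in> borel_measurable unif" "quantile (N i) \<in> borel_measurable unif"
      using M N by (simp_all add: real_distribution.measurable_quantile)
    have q[measurable]: "?q \<in> unif \<rightarrow>\<^sub>M borel" unfolding borel_prod[symmetric] by measurable
    \<comment> \<open>The quantile coupling is the measure that the integral in the claim refers
      to.\<close>
    have "measure_of_joint_cdf (\<lambda>x y. min (marginal_cdf \<mu> i x) (marginal_cdf \<nu> i y)) = distr unif borel ?q"
      using measure_quantile_coupling[OF M N, of i i]
      by (intro measure_of_joint_cdf_eqI unif.prob_space_distr q) (simp_all add: marginal_cdf_def M_def N_def)
    then show "(\<integral>\<^sup>+u. ennreal (\<bar>quantile (M i) u - quantile (N i) u\<bar> powr p) \<partial>unif) =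
      (\<integral>\<^sup>+ z. ennreal (\<bar>fst z - snd z\<bar> powr p)
        \<partial>measure_of_joint_cdf (\<lambda>x y. min (marginal_cdf \<mu> i x) (marginal_cdf \<nu> i y)))"
      by (simp, subst nn_integral_distr) (auto simp: borel_prod[symmetric])
  qed simp
  finally show ?thesis .
qed

end
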